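(* Let $(X,d)$ be a cone metric space associated with a real Banach space $E$ and a normal cone $P\subseteq E$ with normal constant $k$. Suppose that the following condition holds: for all $p,c\in E$, if $c\in P$, $p\le c$ and $-p\le c$, then $\|p\|\le k\|c\|$. Let $r\in E$ with $0\ll r$. If $\{x_n\}$ and $\{y_n\}$ are two $\frac{r}{2k^2}$-Cauchy sequences in $X$, then the sequence $\{d(x_n,y_n)\}$ in $E$ is $\|r\|$-Cauchy.
   Context: Cone: a subset $P$ of a real Banach space $E$ is a cone if (i) $P$ is closed, nonempty and $P\neq\{0\}$; (ii) $ax+by\in P$ for all real $a,b\ge 0$ and all $x,y\in P$; (iii) $x\in P$ and $-x\in P$ imply $x=0$. Orderings: for $x,y\in E$, $x\le y$ means $y-x\in P$, and $x\ll y$ means $y-x\in \operatorname{int}P$ (the interior of $P$). Normal cone: $P$ is normal with normal constant $k$, where $k>0$ is a real number, if for all $x,y\in E$, $0\le x\le y$ implies $\|x\|\le k\|y\|$. Cone metric space: a nonempty set $X$ with a map $d:X\times X\to E$ such that for all $x,y,z\in X$: $0\le d(x,y)$, with $d(x,y)=0$ if and only if $x=y$; $d(x,y)=d(y,x)$; $d(x,y)\le d(x,z)+d(z,y)$. For $\rho\in E$ with $0\ll\rho$ or $\rho=0$, a sequence $\{x_n\}$ in $X$ is $\rho$-Cauchy if for every $\epsilon\in E$ with $0\ll\epsilon$ there is $m\in\mathbb{N}$ such that $d(x_i,x_j)\ll\rho+\epsilon$ for all $i,j\ge m$. For a real number $s\ge 0$, a sequence $\{z_n\}$ in the normed space $E$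 is $s$-Cauchy if for every real $\epsilon>0$ there is $m\in\mathbb{N}$ such that $\|z_i-z_j\|<s+\epsilon$ for all $i,j\ge m$. *)

theory Defs
  imports "HOL-Analysis.Analysis"
begin

text \<open>Not the library predicate \<open>cone\<close>, which only asks for closure under nonnegative scaling.\<close>

definition banach_cone :: "'e::banach set \<Rightarrow> bool" where
  "banach_cone P \<longleftrightarrow>
     closed P \<and> P \<noteq> {} \<and> P \<noteq> {0} \<and>
     (\<forall>a b x y. 0 \<le> a \<and> 0 \<le> b \<and> x \<in> P \<and> y \<in> P \<longrightarrow> a *\<^sub>R x + b *\<^sub>R y \<in> P) \<and>
     (\<forall>x. x \<in> P \<and> - x \<in> P \<longrightarrow> x = 0)"

definition cone_le :: "'e::banach set \<Rightarrow> 'e \<Rightarrow> 'e \<Rightarrow> bool" where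
  "cone_le P x y \<longleftrightarrow> y - x \<in> P"

definition cone_ll :: "'e::banach set \<Rightarrow> 'e \<Rightarrow> 'e \<Rightarrow> bool" where
  "cone_ll P x y \<longleftrightarrow> y - x \<in> interior P"

definition normal_cone :: "'e::banach set \<Rightarrow> real \<Rightarrow> bool" where
  "normal_cone P k \<longleftrightarrow>
     banach_cone P \<and> k > 0 \<and>
     (\<forall>x y. cone_le P 0 x \<and> cone_le P x y \<longrightarrow> norm x \<le> k * norm y)"

definition cone_metric_space :: "'e::banach set \<Rightarrow> 'a set \<Rightarrow> ('a \<Rightarrow> 'a \<Rightarrow> 'e) \<Rightarrow> bool" where
  "cone_metric_space P X d \<longleftrightarrow>
     banach_cone P \<and> X \<noteq> {} \<and>
     (\<forall>x\<in>X. \<forall>y\<in>X. cone_le P 0 (d x y) \<and> (d x y = 0 \<longleftrightarrow> x = y)) \<and>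
     (\<forall>x\<in>X. \<forall>y\<in>X. d x y = d y x) \<and>
     (\<forall>x\<in>X. \<forall>y\<in>X. \<forall>z\<in>X. cone_le P (d x y) (d x z + d z y))"

text \<open>Intended for \<open>\<rho> = 0\<close> or \<open>cone_ll P 0 \<rho>\<close>, and for sequences with values in the carrier
  of the cone metric space.\<close>

definition rho_Cauchy :: "'e::banach set \<Rightarrow> ('a \<Rightarrow> 'a \<Rightarrow> 'e) \<Rightarrow> 'e \<Rightarrow> (nat \<Rightarrow> 'a) \<Rightarrow> bool" where
  "rho_Cauchy P d \<rho> x \<longleftrightarrow>
     (\<forall>\<epsilon>. cone_ll P 0 \<epsilon> \<longrightarrow>
        (\<exists>m. \<forall>i\<ge>m. \<forall>j\<ge>m. cone_ll P (d (x i) (x j)) (\<rho> + \<epsilon>)))"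

text \<open>Intended for \<open>s \<ge> 0\<close>.\<close>

definition norm_Cauchy :: "real \<Rightarrow> (nat \<Rightarrow> 'e::real_normed_vector) \<Rightarrow> bool" where
  "norm_Cauchy s z \<longleftrightarrow>
     (\<forall>\<epsilon>>0. \<exists>m. \<forall>i\<ge>m. \<forall>j\<ge>m. norm (z i - z j) < s + \<epsilon>)"

end

theory Submission
  imports Defs
begin

text \<open>By the triangle inequality, \<open>\<plusminus>(d x\<^sub>i y\<^sub>i - d x\<^sub>j y\<^sub>j)\<close> lie below
  \<open>c = d x\<^sub>i x\<^sub>j + d y\<^sub>i y\<^sub>j\<close>. Taking \<open>\<epsilon> = t r\<close> in the Cauchy conditions puts \<open>c\<close> below
  \<open>(1 / k\<^sup>2 + 2 t) r\<close>. One factor \<open>k\<close> is lost to the symmetric normality condition and another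
  to normality, so the difference has norm at most \<open>(1 + 2 k\<^sup>2 t) \<parallel>r\<parallel>\<close>, and \<open>t\<close> is arbitrary.\<close>

lemma banach_cone_combination:
  "banach_cone P \<Longrightarrow> 0 \<le> a \<Longrightarrow> 0 \<le> b \<Longrightarrow> x \<in> P \<Longrightarrow> y \<in> P \<Longrightarrow> a *\<^sub>R x + b *\<^sub>R y \<in> P"
  by (simp add: banach_cone_def)

lemma banach_cone_add: "banach_cone P \<Longrightarrow> x \<in> P \<Longrightarrow> y \<in> P \<Longrightarrow> x + y \<in> P"
  using banach_cone_combination[of P 1 1 x y] by simp

lemma banach_cone_scaleR: "banach_cone P \<Longrightarrow> 0 \<le> a \<Longrightarrow> x \<in> P \<Longrightarrow> a *\<^sub>R x \<in> P"
  using banach_cone_combination[of P a 0 x x] by simp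

text \<open>Scaling by \<open>a > 0\<close> is a homeomorphism, so it maps the interior to an open
  set. This set stays inside \<open>P\<close>, hence inside the largest open subset of
  \<open>P\<close>.\<close>

lemma banach_cone_interior_scaleR:
  assumes "banach_cone P" "0 < a" "x \<in> interior P"
  shows "a *\<^sub>R x \<in> interior P"
proof -
  have "open ((*\<^sub>R) a ` interior P)"
    using assms(2) by (intro open_scaling) auto
  moreover have "(*\<^sub>R) a ` interior P \<subseteq> P"
    using assms(1,2) interior_subset[of P] by (auto intro!: banach_cone_scaleR)
  ultimately have "(*\<^sub>R) a ` interior P \<subseteq> interior P"
    by (rule interior_maximal[rotated])
  then show ?thesis using assms(3) by blast
qed

lemma cone_ll_imp_cone_le: "cone_ll P x y \<Longrightarrow> cone_le P x y"
  unfolding cone_ll_def cone_le_def using interior_subset by blast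

lemma cone_le_trans:
  "banach_cone P \<Longrightarrow> cone_le P x y \<Longrightarrow> cone_le P y z \<Longrightarrow> cone_le P x z"
  using banach_cone_add[of P "y - x" "z - y"] by (simp add: cone_le_def)

lemma cone_le_add_mono:
  "banach_cone P \<Longrightarrow> cone_le P a b \<Longrightarrow> cone_le P c e \<Longrightarrow> cone_le P (a + c) (b + e)"
  using banach_cone_add[of P "b - a" "e - c"] by (simp add: cone_le_def algebra_simps)

text \<open>Two triangle inequalities, the first through \<open>u'\<close> and the second through
  \<open>v'\<close>, followed by symmetry of \<open>d\<close>.\<close>

lemma cone_metric_quadrilateral:
  assumes "cone_metric_space P X d" "u \<in> X" "v \<in> X" "u' \<in> X" "v' \<in> X"
  shows "cone_le P (d u v - d u' v') (d u u' + d v v')"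
proof -
  have P: "banach_cone P"
    using assms(1) unfolding cone_metric_space_def by blast
  have tri: "cone_le P (d a b) (d a c + d c b)" if "a \<in> X" "b \<in> X" "c \<in> X" for a b c
    using assms(1) that unfolding cone_metric_space_def by blast
  have "cone_le P (d u v) (d u u' + d u' v)"
    using tri assms by blast
  \<comment> \<open>The summand \<open>d u u'\<close> cancels in the difference, leaving the
    triangle inequality for \<open>u'\<close>, \<open>v\<close> through \<open>v'\<close>.\<close>
  moreover have "cone_le P (d u u' + d u' v) (d u u' + (d u' v' + d v' v))"
    using tri[of u' v v'] assms by (simp add: cone_le_def)
  ultimately have "cone_le P (d u v) (d u u' + (d u' v' + d v' v))"
    using cone_le_trans[OF P] by blast
  moreover have "d v' v = d v v'"
    using assms unfolding cone_metric_space_def by blast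
  ultimately show ?thesis by (simp add: cone_le_def algebra_simps)
qed

theorem theorem3p3:
  fixes P :: "'e::banach set" and k :: real
    and X :: "'a set" and d :: "'a \<Rightarrow> 'a \<Rightarrow> 'e"
    and r :: 'e and x y :: "nat \<Rightarrow> 'a"
  assumes "normal_cone P k"
    and "cone_metric_space P X d"
    and "\<And>p c. c \<in> P \<Longrightarrow> cone_le P p c \<Longrightarrow> cone_le P (- p) c \<Longrightarrow> norm p \<le> k * norm c"
    and "cone_ll P 0 r"
    and "\<And>n. x n \<in> X" and "\<And>n. y n \<in> X"
    and "rho_Cauchy P d (r /\<^sub>R (2 * k\<^sup>2)) x"
    and "rho_Cauchy P d (r /\<^sub>R (2 * k\<^sup>2)) y"
  shows "norm_Cauchy (norm r) (\<lambda>n. d (x n) (y n))"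
  unfolding norm_Cauchy_def
proof (intro allI impI)
  fix e :: real assume e: "e > 0"
  have P: "banach_cone P" and k: "k > 0"
    and normal: "\<And>u v. cone_le P 0 u \<Longrightarrow> cone_le P u v \<Longrightarrow> norm u \<le> k * norm v"
    using assms(1) by (auto simp: normal_cone_def)
  have d_nonneg: "d u v \<in> P" if "u \<in> X" "v \<in> X" for u v
    using assms(2) that unfolding cone_metric_space_def cone_le_def by (metis diff_zero)
  have d_sym: "d u v = d v u" if "u \<in> X" "v \<in> X" for u v
    using assms(2) that unfolding cone_metric_space_def by blast
  \<comment> \<open>Chosen so that the final error \<open>2 * k\<^sup>2 * t * norm r\<close> is
    strictly below \<open>e\<close>; the \<open>+ 1\<close> gives strictness and a positive
    denominator.\<close>
  define t where "t = e / (2 * k\<^sup>2 * (norm r + 1))"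
  have "0 < norm r + 1" by (simp add: add_nonneg_pos)
  then have t: "t > 0" using e k by (simp add: t_def)
  have "2 * k\<^sup>2 * t * (norm r + 1) = e"
    using k \<open>0 < norm r + 1\<close> by (simp add: t_def)
  moreover have "2 * k\<^sup>2 * t * norm r < 2 * k\<^sup>2 * t * (norm r + 1)"
    using k t by simp
  ultimately have te: "2 * k\<^sup>2 * t * norm r < e" by linarith
  \<comment> \<open>A multiple of \<open>r\<close> itself serves as the cone-valued tolerance, so
    that all bounds merge into one multiple of \<open>r\<close>.\<close>
  have "cone_ll P 0 (t *\<^sub>R r)"
    using banach_cone_interior_scaleR[OF P t] assms(4) by (simp add: cone_ll_def)
  then obtain m n where
    m: "\<forall>i\<ge>m. \<forall>j\<ge>m. cone_ll P (d (x i) (x j)) (r /\<^sub>R (2 * k\<^sup>2) + t *\<^sub>R r)" and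
    n: "\<forall>i\<ge>n. \<forall>j\<ge>n. cone_ll P (d (y i) (y j)) (r /\<^sub>R (2 * k\<^sup>2) + t *\<^sub>R r)"
    using assms(7,8) unfolding rho_Cauchy_def by blast
  show "\<exists>m. \<forall>i\<ge>m. \<forall>j\<ge>m. norm (d (x i) (y i) - d (x j) (y j)) < norm r + e"
  proof (intro exI[of _ "max m n"] allI impI)
    fix i j assume "i \<ge> max m n" "j \<ge> max m n"
    then have ij: "i \<ge> m" "j \<ge> m" "i \<ge> n" "j \<ge> n" by auto
    define p where "p = d (x i) (y i) - d (x j) (y j)"
    define c where "c = d (x i) (x j) + d (y i) (y j)"
    \<comment> \<open>Each of the two sequences contributes
      \<open>1 / (2 * k\<^sup>2) + t\<close>.\<close>
    define b where "b = 1 / k\<^sup>2 + 2 * t"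
    have b: "b > 0" using k t by (simp add: b_def add_pos_pos)
    have "cone_le P c ((r /\<^sub>R (2 * k\<^sup>2) + t *\<^sub>R r) + (r /\<^sub>R (2 * k\<^sup>2) + t *\<^sub>R r))"
      unfolding c_def using m n ij by (intro cone_le_add_mono P cone_ll_imp_cone_le) auto
    also have "(r /\<^sub>R (2 * k\<^sup>2) + t *\<^sub>R r) + (r /\<^sub>R (2 * k\<^sup>2) + t *\<^sub>R r) = b *\<^sub>R r"
      unfolding b_def scaleR_add_left[symmetric] using k by (simp add: field_simps)
    finally have cb: "cone_le P c (b *\<^sub>R r)" .
    have cP: "c \<in> P" unfolding c_def
      using d_nonneg assms(5,6) by (intro banach_cone_add P) auto
    have "norm p \<le> k * norm c"
    proof (rule assms(3)[OF cP])
      show "cone_le P p c" unfolding p_def c_def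
        using assms(2,5,6) by (intro cone_metric_quadrilateral)
      \<comment> \<open>The same inequality with \<open>i\<close> and \<open>j\<close> exchanged;
        symmetry of \<open>d\<close> turns its right side back into \<open>c\<close>.\<close>
      have "cone_le P (d (x j) (y j) - d (x i) (y i)) (d (x j) (x i) + d (y j) (y i))"
        using assms(2,5,6) by (intro cone_metric_quadrilateral)
      then show "cone_le P (- p) c" unfolding p_def c_def
        using d_sym assms(5,6) by simp
    qed
    \<comment> \<open>Normality applied to \<open>c\<close> between \<open>0\<close> and
      \<open>b *\<^sub>R r\<close> costs the second factor \<open>k\<close>.\<close>
    also have "\<dots> \<le> k * (k * norm (b *\<^sub>R r))"
      using normal[OF _ cb] cP k by (simp add: cone_le_def)
    also have "\<dots> = k\<^sup>2 * b * norm r"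
      using b by (simp add: power2_eq_square)
    \<comment> \<open>The two losses of \<open>k\<close> cancel the \<open>1 / k\<^sup>2\<close> in
      \<open>b\<close>, which leaves exactly \<open>norm r\<close> as the leading term.\<close>
    also have "k\<^sup>2 * b = 1 + 2 * k\<^sup>2 * t"
      using k by (simp add: b_def field_simps)
    also have "(1 + 2 * k\<^sup>2 * t) * norm r < norm r + e"
      using te by (simp add: algebra_simps)
    finally show "norm (d (x i) (y i) - d (x j) (y j)) < norm r + e"
      by (simp add: p_def)
  qed
qed

end
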